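(* Let $S$ be a countable state space with $\sigma$-algebra $2^S$, let $\mu$ be an initial distribution and $P$ a transition kernel on $S$, and let $(A_1,B_1),\dots,(A_k,B_k)$ with $A_i,B_i\subseteq S$ be a Streett acceptance condition. Suppose there exist: - $I\subseteq S$; - $V_0:S\to\mathbb R_{\ge0}$; - $J_i\subseteq I\setminus A_i$; - $V_i,W_i:S\to\mathbb R_{\ge0}$; - $d_i:\mathbb R_{\ge0}\to\mathbb R_{>0}$; - $p_i:\mathbb R_{\ge0}\to(0,1]$ for $i=1,\dots,k$; such that, for every $i=1,\dots,k$: 1. $\forall s\notin A_i$: $PV_i(s)\le V_i(s)$; 2. $\forall s\in A_i$: $V_i(s)\ge1$; 3. $\exists\gamma_i>0\ \forall s\in J_i$: $V_i(s)\le1-\gamma_i$; 4. $\forall s\in I\setminus(B_i\cup J_i)$: $W_i(s)>0$; 5. $\forall s\in I\cap(B_i\cup J_i)$: $W_i(s)=0$; 6. $\forall s\in I\setminus(B_i\cup J_i)$: $PW_i(s)\le W_i(s)$; 7. $\forall r>0\ \forall s\in I\setminus(B_i\cup J_i)$: if $W_i(s)=r$ then $P(s,\{s':W_i(s')\le r-d_i(r)\})\ge p_i(r)$; 8. $\forall r_1,r_2>0$: $r_1\le r_2\Rightarrow p_i(r_1)\ge p_i(r_2)$; 9. $\forall r_1,r_2>0$: $r_1\le r_2\Rightarrow d_i(r_1)\ge d_i(r_2)$; and moreover: 10. $\forall s\in I$: $PV_0(s)\le V_0(s)$; 11. $\forall s\notin I$: $V_0(s)\ge1$. Then $$\mathsf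 P_\mu\Big(\bigcap_{i=1}^k\mathrm{Fin}(A_i)\cup\mathrm{Inf}(B_i)\Big)\ge1-\mu V_0.$$
   Context: Setting. - $\mathsf P_\mu$ is the law on $S^\omega$ of the time-homogeneous Markov chain $(\Phi_n)$ with initial distribution $\mu$ and kernel $P$. - $\mathrm{Fin}(A)=\bigcup_{n}\bigcap_{m\ge n}\{\Phi_m\notin A\}$ and $\mathrm{Inf}(A)=\bigcap_n\bigcup_{m\ge n}\{\Phi_m\in A\}$. Notation. $PV(s)=\sum_u V(u)P(s,\{u\})$ and $\mu V=\sum_s V(s)\mu(\{s\})$. *)

theory Defs
  imports "HOL-Probability.Probability"
begin

text \<open>On a countable type \<open>'s\<close> the probability measures on the power-set \<open>\<sigma>\<close>-algebra are exactly
  the elements of \<open>'s pmf\<close>, so a distribution is an \<open>'s pmf\<close> and a transition kernel a function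
  \<open>'s \<Rightarrow> 's pmf\<close>.\<close>

definition chain_step :: "'s pmf \<Rightarrow> ('s \<Rightarrow> 's pmf) \<Rightarrow> nat \<Rightarrow> (nat \<Rightarrow> 's) \<Rightarrow> 's measure" where
  "chain_step \<mu> P n \<omega> =
     (case n of 0 \<Rightarrow> measure_pmf \<mu> | Suc m \<Rightarrow> measure_pmf (P (\<omega> m)))"

text \<open>The law of the chain on the product \<open>\<sigma>\<close>-algebra over \<open>nat \<Rightarrow> 's\<close>, as the Ionescu-Tulcea limit of
  the one-step kernels; \<open>emeasure_chain_law_cylinder\<close> below gives its finite-dimensional
  distributions.\<close>

definition chain_law :: "'s::countable pmf \<Rightarrow> ('s \<Rightarrow> 's pmf) \<Rightarrow> (nat \<Rightarrow> 's) measure" where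
  "chain_law \<mu> P =
     projective_family.lim UNIV
       (Ionescu_Tulcea.CI (chain_step \<mu> P) (\<lambda>_. count_space UNIV)) (\<lambda>_. count_space UNIV)"

definition fin_visits :: "'s set \<Rightarrow> (nat \<Rightarrow> 's) set" where
  "fin_visits A = (\<Union>n. \<Inter>m\<in>{n..}. {\<omega>. \<omega> m \<notin> A})"

definition inf_visits :: "'s set \<Rightarrow> (nat \<Rightarrow> 's) set" where
  "inf_visits A = (\<Inter>n. \<Union>m\<in>{n..}. {\<omega>. \<omega> m \<in> A})"

text \<open>\<open>\<mu> V = (\<Sum>s. V s * \<mu> {s})\<close> for \<open>V \<ge> 0\<close>, and \<open>P V s = (P s) V\<close>. The sums may diverge, hence
  the values are extended non-negative reals.\<close>

definition pmf_sum :: "'s pmf \<Rightarrow> ('s \<Rightarrow> real) \<Rightarrow> ennreal" where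
  "pmf_sum \<mu> V = (\<Sum>\<^sub>\<infinity>s. ennreal (V s * pmf \<mu> s))"

definition kernel_sum :: "('s \<Rightarrow> 's pmf) \<Rightarrow> ('s \<Rightarrow> real) \<Rightarrow> 's \<Rightarrow> ennreal" where
  "kernel_sum P V s = (\<Sum>\<^sub>\<infinity>u. ennreal (V u * pmf (P s) u))"

lemma infsum_eq_nn_integral_count_space:
  fixes f :: "'s::countable \<Rightarrow> ennreal"
  shows "(\<Sum>\<^sub>\<infinity>s. f s) = (\<integral>\<^sup>+s. f s \<partial>count_space UNIV)"
proof -
  have fin: "(\<integral>\<^sup>+s. f s * indicator F s \<partial>count_space UNIV) = sum f F" if "finite F" for F
    using that nn_integral_count_space_indicator[of F f] nn_integral_count_space_finite[of F f]
    by simp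
  have sup: "(\<Sum>\<^sub>\<infinity>s. f s) = (SUP F\<in>{F. finite F}. sum f F)"
    by (simp add: nonneg_infsum_complete)
  define F where "F n = {s::'s. to_nat s < n}" for n
  have F: "finite (F n)" for n
    unfolding F_def by (rule finite_imageD[of to_nat])
      (auto intro: finite_subset[of _ "{..<n}"] inj_on_subset[OF inj_to_nat])
  have "(\<integral>\<^sup>+s. f s \<partial>count_space UNIV) = (\<integral>\<^sup>+s. (SUP n. f s * indicator (F n) s) \<partial>count_space UNIV)"
  proof (intro nn_integral_cong antisym SUP_least)
    fix s
    show "f s \<le> (SUP n. f s * indicator (F n) s)"
      by (rule SUP_upper2[of "Suc (to_nat s)"]) (simp_all add: F_def)
    show "f s * indicator (F n) s \<le> f s" for n
      by (simp add: indicator_def)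
  qed
  also have "\<dots> = (SUP n. \<integral>\<^sup>+s. f s * indicator (F n) s \<partial>count_space UNIV)"
    by (rule nn_integral_monotone_convergence_SUP)
      (auto simp: incseq_def le_fun_def F_def indicator_def)
  also have "\<dots> = (SUP n. sum f (F n))"
    using fin F by simp
  also have "\<dots> \<le> (\<Sum>\<^sub>\<infinity>s. f s)"
    unfolding sup using F by (intro SUP_least SUP_upper) auto
  finally have le: "(\<integral>\<^sup>+s. f s \<partial>count_space UNIV) \<le> (\<Sum>\<^sub>\<infinity>s. f s)" .
  have "sum f G \<le> (\<integral>\<^sup>+s. f s \<partial>count_space UNIV)" if "finite G" for G
    unfolding fin[OF that, symmetric] by (intro nn_integral_mono) (simp add: indicator_def)
  then have "(\<Sum>\<^sub>\<infinity>s. f s) \<le> (\<integral>\<^sup>+s. f s \<partial>count_space UNIV)"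
    unfolding sup by (intro SUP_least) auto
  with le show ?thesis by simp
qed

lemma pmf_sum_eq_nn_integral:
  fixes \<mu> :: "'s::countable pmf"
  assumes "\<And>s. V s \<ge> 0"
  shows "pmf_sum \<mu> V = (\<integral>\<^sup>+s. ennreal (V s) \<partial>measure_pmf \<mu>)"
  unfolding pmf_sum_def infsum_eq_nn_integral_count_space nn_integral_measure_pmf
  by (intro nn_integral_cong) (simp add: assms ennreal_mult mult.commute)

lemma kernel_sum_eq_nn_integral:
  fixes P :: "'s::countable \<Rightarrow> 's pmf"
  assumes "\<And>s. V s \<ge> 0"
  shows "kernel_sum P V s = (\<integral>\<^sup>+u. ennreal (V u) \<partial>measure_pmf (P s))"
  using pmf_sum_eq_nn_integral[of V "P s"] assms by (simp add: kernel_sum_def pmf_sum_def)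

lemma Ionescu_Tulcea_chain_step:
  fixes \<mu> :: "'s::countable pmf"
  shows "Ionescu_Tulcea (chain_step \<mu> P) (\<lambda>_. count_space UNIV)"
proof (rule Ionescu_Tulcea.intro)
  show "prob_space (chain_step \<mu> P i x)" for i x
    by (cases i) (simp_all add: chain_step_def prob_space_measure_pmf)
  show "chain_step \<mu> P i \<in> measurable (PiM {0..<i} (\<lambda>_. count_space UNIV))
      (subprob_algebra (count_space UNIV))" for i
  proof (cases i)
    case 0
    then show ?thesis by (simp add: chain_step_def[abs_def] measure_pmf_in_subprob_algebra)
  next
    case (Suc m)
    have "(\<lambda>\<omega>. \<omega> m) \<in> measurable (PiM {0..<i} (\<lambda>_. count_space UNIV)) (count_space UNIV)"
      using Suc by (intro measurable_component_singleton) auto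
    moreover have "(\<lambda>s. measure_pmf (P s)) \<in>
        measurable (count_space UNIV) (subprob_algebra (count_space UNIV))"
      by (simp add: measure_pmf_in_subprob_algebra)
    ultimately show ?thesis
      using Suc by (simp add: chain_step_def[abs_def] measurable_compose)
  qed
qed

lemma sets_chain_law [measurable_cong, simp]:
  "sets (chain_law \<mu> P) = sets (PiM UNIV (\<lambda>_. count_space UNIV))"
proof -
  interpret Ionescu_Tulcea "chain_step \<mu> P" "\<lambda>_. count_space UNIV"
    by (rule Ionescu_Tulcea_chain_step)
  show ?thesis unfolding chain_law_def by (rule PF.sets_lim)
qed

lemma space_chain_law [simp]: "space (chain_law \<mu> P) = UNIV"
  using sets_eq_imp_space_eq[OF sets_chain_law] by (simp add: space_PiM)

lemma emeasure_chain_law_cylinder: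
  fixes \<mu> :: "'s::countable pmf"
  shows "emeasure (chain_law \<mu> P) {\<omega>. \<forall>i\<le>n. \<omega> i = x i} =
    ennreal (pmf \<mu> (x 0) * (\<Prod>i<n. pmf (P (x i)) (x (Suc i))))"
proof -
  interpret Ionescu_Tulcea "chain_step \<mu> P" "\<lambda>_. count_space UNIV"
    by (rule Ionescu_Tulcea_chain_step)
  let ?M = "\<lambda>_::nat. count_space (UNIV :: 's set)"
  let ?X = "\<lambda>n. PiE {0..<n} (\<lambda>i. {x i})"
  have X[measurable]: "?X n \<in> sets (PiM {0..<n} ?M)" for n
    by (intro sets_PiM_I_finite) auto
  have "emeasure (chain_law \<mu> P) {\<omega>. \<forall>i\<le>n. \<omega> i = x i} =
      emeasure PF.lim (PF.emb UNIV {0..<Suc n} (?X (Suc n)))"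
    unfolding chain_law_def
    by (intro arg_cong2[where f=emeasure] refl)
      (auto simp: prod_emb_def space_PiM PiE_iff less_Suc_eq_le)
  also have "\<dots> = emeasure (C 0 (Suc n) (\<lambda>_. undefined)) (?X (Suc n))"
    by (subst lim) (auto simp: emeasure_CI[of _ "Suc n"] simp del: C.simps)
  also have "\<dots> = ennreal (pmf \<mu> (x 0) * (\<Prod>i<n. pmf (P (x i)) (x (Suc i))))"
  proof (induction n)
    case 0
    have "?X (Suc 0) = {(\<lambda>_. undefined)(0 := x 0)}"
      by (auto simp: PiE_def extensional_def fun_eq_iff)
    then have eq: "fun_upd (\<lambda>_. undefined) 0 -` ?X (Suc 0) = {x 0}"
      by (auto dest: fun_cong[of _ _ 0])
    have sp: "(\<lambda>_. undefined) \<in> space (PiM {0..<0} ?M)"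
      by (simp add: space_PiM)
    have "C 0 (Suc 0) (\<lambda>_. undefined) = eP 0 (\<lambda>_. undefined)"
      using bind_return[OF measurable_eP sp] by simp
    then have "emeasure (C 0 (Suc 0) (\<lambda>_. undefined)) (?X (Suc 0)) =
        emeasure (chain_step \<mu> P 0 (\<lambda>_. undefined)) {x 0}"
      using emeasure_eP[OF sp X] eq by simp
    also have "\<dots> = ennreal (pmf \<mu> (x 0))"
      unfolding chain_step_def by (simp add: emeasure_pmf_single)
    finally show ?case by simp
  next
    case (Suc n)
    let ?C = "C 0 (Suc n) (\<lambda>_. undefined)"
    have spC: "space ?C = space (PiM {0..<Suc n} ?M)"
      using space_C[of "\<lambda>_. undefined" 0 "Suc n"] by simp
    have setC: "sets ?C = sets (PiM {0..<Suc n} ?M)"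
      using sets_C[of "\<lambda>_. undefined" 0 "Suc n"] by simp
    have chain_step_Suc: "chain_step \<mu> P (Suc n) \<omega> = measure_pmf (P (\<omega> n))" for \<omega>
      by (simp add: chain_step_def)
    have step: "emeasure (eP (Suc n) \<omega>) (?X (Suc (Suc n))) =
        ennreal (pmf (P (x n)) (x (Suc n))) * indicator (?X (Suc n)) \<omega>"
      if \<omega>: "\<omega> \<in> space (PiM {0..<Suc n} ?M)" for \<omega>
    proof -
      have ext: "\<omega> \<in> extensional {0..<Suc n}"
        using \<omega> by (simp add: space_PiM PiE_iff)
      have "fun_upd \<omega> (Suc n) y \<in> ?X (Suc (Suc n)) \<longleftrightarrow> \<omega> \<in> ?X (Suc n) \<and> y = x (Suc n)" for y
      proof -
        have "fun_upd \<omega> (Suc n) y \<in> ?X (Suc (Suc n)) \<longleftrightarrow>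
            (\<forall>i<Suc (Suc n). fun_upd \<omega> (Suc n) y i = x i)"
          using ext by (auto simp: PiE_iff extensional_def)
        also have "\<dots> \<longleftrightarrow> (\<forall>i<Suc n. \<omega> i = x i) \<and> y = x (Suc n)"
          by (subst All_less_Suc) auto
        also have "\<dots> \<longleftrightarrow> \<omega> \<in> ?X (Suc n) \<and> y = x (Suc n)"
          using ext by (auto simp: PiE_iff)
        finally show ?thesis .
      qed
      then have "fun_upd \<omega> (Suc n) -` ?X (Suc (Suc n)) =
          (if \<omega> \<in> ?X (Suc n) then {x (Suc n)} else {})"
        by auto
      then show ?thesis
        using emeasure_eP[OF \<omega> X]
        by (auto simp: chain_step_Suc emeasure_pmf_single PiE_iff)
    qed
    have "emeasure (C 0 (Suc (Suc n)) (\<lambda>_. undefined)) (?X (Suc (Suc n))) =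
        (\<integral>\<^sup>+\<omega>. emeasure (eP (Suc n) \<omega>) (?X (Suc (Suc n))) \<partial>?C)"
      unfolding C.simps(2)[of 0 "Suc n"] add_0
      by (rule emeasure_bind[where N="PiM {0..<Suc (Suc n)} ?M"])
        (auto simp: spC setC space_PiM_not_empty measurable_cong_sets[OF setC refl] simp del: C.simps)
    also have "\<dots> = (\<integral>\<^sup>+\<omega>. ennreal (pmf (P (x n)) (x (Suc n))) * indicator (?X (Suc n)) \<omega> \<partial>?C)"
      by (intro nn_integral_cong) (simp add: step spC del: C.simps)
    also have "\<dots> = ennreal (pmf (P (x n)) (x (Suc n))) * emeasure ?C (?X (Suc n))"
      using X[of "Suc n"] by (intro nn_integral_cmult_indicator) (simp add: setC del: C.simps)
    also have "\<dots> = ennreal (pmf \<mu> (x 0) * (\<Prod>i<Suc n. pmf (P (x i)) (x (Suc i))))"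
      unfolding Suc.IH by (simp add: ennreal_mult prod_nonneg mult_ac)
    finally show ?case .
  qed
  finally show ?thesis .
qed

lemma prob_space_chain_law: "prob_space (chain_law \<mu> P)"
proof -
  interpret Ionescu_Tulcea "chain_step \<mu> P" "\<lambda>_. count_space UNIV"
    by (rule Ionescu_Tulcea_chain_step)
  have "prob_space (distr PF.lim (PiM {} (\<lambda>_. count_space UNIV)) (\<lambda>x. restrict x {}))"
    unfolding distr_lim[OF finite.emptyI] by (rule PF.prob_space_P) auto
  then show ?thesis
    unfolding chain_law_def
    by (rule prob_space_distrD[rotated])
      (intro measurable_restrict, simp)
qed

lemma sets_fin_visits [measurable]: "fin_visits A \<in> sets (chain_law \<mu> P)"
proof -
  have "{\<omega>. \<omega> m \<notin> A} = (\<lambda>\<omega>. \<omega> m) -` (- A) \<inter> space (PiM UNIV (\<lambda>_. count_space UNIV))" for m :: nat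
    by (auto simp: space_PiM)
  then have "{\<omega>. \<omega> m \<notin> A} \<in> sets (PiM UNIV (\<lambda>_. count_space UNIV))" for m :: nat
    by (simp add: measurable_sets[OF measurable_component_singleton])
  then show ?thesis unfolding fin_visits_def sets_chain_law
    by (intro sets.countable_UN' sets.countable_INT'') auto
qed

lemma inf_visits_eq: "inf_visits A = UNIV - fin_visits A"
  by (auto simp: inf_visits_def fin_visits_def)

lemma sets_inf_visits [measurable]: "inf_visits A \<in> sets (chain_law \<mu> P)"
  unfolding inf_visits_eq using sets.compl_sets[OF sets_fin_visits[of A \<mu> P]] by simp

end

theory Submission
  imports Defs
begin

text \<open>
  A nonnegative function that is superharmonic until the chain enters \<open>A\<close> and at least \<open>1\<close> on \<open>A\<close>
  bounds the probability of reaching \<open>A\<close>. Applied to \<open>V\<^sub>0\<close> this bounds the probability of ever leaving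
  \<open>I\<close> by \<open>\<mu> V\<^sub>0\<close>, so it remains to see that for each pair the event \<open>E\<close> that the chain is eventually
  in \<open>I - B\<close> and visits \<open>A\<close> infinitely often is null.

  The chain cannot stay in \<open>I - (B \<union> J)\<close> forever: while \<open>W \<le> R\<close>, a bounded number of consecutive
  decreases, each of probability at least \<open>p R\<close> and size at least \<open>d R\<close>, would make \<open>W\<close> vanish, and
  \<open>W\<close> exceeds \<open>R\<close> with probability at most \<open>W s / R\<close>, which tends to \<open>0\<close> as \<open>R\<close> grows. Hence
  almost every path of \<open>E\<close> reaches both \<open>A\<close> and \<open>J\<close>. Let \<open>H\<close> be the supremum over the starting
  states of the probability of the shift-invariant event \<open>E\<close>. Stopping on entering \<open>A\<close> gives the bound
  \<open>H * V s\<close>, hence \<open>(1 - \<gamma>) * H\<close> on \<open>J\<close>; stopping on entering \<open>J\<close> extends the latter to all states,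
  so \<open>H \<le> (1 - \<gamma>) * H\<close> and \<open>H = 0\<close>.
\<close>

section \<open>The path space and its cylinders\<close>

abbreviation seqs :: "(nat \<Rightarrow> 's::countable) measure" where
  "seqs \<equiv> PiM UNIV (\<lambda>_. count_space UNIV)"

text \<open>The states are countable, so a constraint on coordinate \<open>i\<close> is a countable
  union of cylinders, indexed by the lists of length \<open>Suc i\<close> of possible values at
  times \<open>0\<close> to \<open>i\<close>. \<open>UNIV\<close> and \<open>{}\<close> join the
  generator because uniqueness of measures needs a covering set and closure under
  intersection.\<close>

lemma sets_seqs_generated_by_cylinders:
  "sets (seqs :: (nat \<Rightarrow> 's::countable) measure) =
     sigma_sets UNIV (insert UNIV (insert {} (range (\<lambda>(n, x). {\<omega>. \<forall>i\<le>n. \<omega> i = x i}))))"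
    (is "_ = sigma_sets UNIV ?G")
proof
  have "{f \<in> UNIV. f i \<in> X} \<in> sigma_sets UNIV ?G" for i and X :: "'s set"
  proof -
    have "{f. f i \<in> X} = (\<Union>xs\<in>{xs. length xs = Suc i \<and> xs ! i \<in> X}. {\<omega>. \<forall>j\<le>i. \<omega> j = xs ! j})"
      (is "_ = ?U")
    proof (intro set_eqI iffI)
      fix f assume "f \<in> {f. f i \<in> X}"
      then show "f \<in> ?U"
        by (intro UN_I[of "map f [0..<Suc i]"]) (auto simp del: upt_Suc)
    qed auto
    moreover have "{\<omega>. \<forall>j\<le>i. \<omega> j = xs ! j} \<in> ?G" for xs :: "'s list"
      by (intro insertI2 range_eqI[of _ _ "(i, \<lambda>j. xs ! j)"]) simp
    ultimately show ?thesis
      using sigma_algebra.countable_UN'[OF sigma_algebra_sigma_sets[of ?G UNIV],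
          of "{xs. length xs = Suc i \<and> xs ! i \<in> X}" "\<lambda>xs. {\<omega>. \<forall>j\<le>i. \<omega> j = xs ! j}"]
      by (simp add: image_subset_iff sigma_sets.Basic)
  qed
  then show "sets seqs \<subseteq> sigma_sets UNIV ?G"
    unfolding sets_PiM_single space_count_space PiE_UNIV_domain Pi_UNIV
    by (intro sigma_sets_mono) blast
  have "{\<omega> \<in> space seqs. \<forall>i\<le>n. \<omega> i = x i} \<in> sets seqs" for n and x :: "nat \<Rightarrow> 's"
    by measurable
  then have "?G \<subseteq> sets seqs"
    using sets.top[of "seqs :: (nat \<Rightarrow> 's) measure"] by (auto simp: space_PiM)
  then show "sigma_sets UNIV ?G \<subseteq> sets seqs"
    using sets.sigma_sets_subset[of ?G "seqs :: (nat \<Rightarrow> 's) measure"] by (simp add: space_PiM)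
qed

text \<open>Two cylinders are nested if they agree up to the shorter length and disjoint
  otherwise.\<close>

lemma Int_stable_cylinders:
  "Int_stable (insert UNIV (insert {} (range (\<lambda>(n, x). {\<omega> :: nat \<Rightarrow> 'a. \<forall>i\<le>n. \<omega> i = x i}))))"
    (is "Int_stable ?G")
proof -
  have *: "{\<omega>. \<forall>i\<le>n. \<omega> i = x i} \<inter> {\<omega>. \<forall>i\<le>m. \<omega> i = y i} \<in> ?G"
    if "n \<le> m" for n m :: nat and x y :: "nat \<Rightarrow> 'a"
  proof (cases "\<forall>i\<le>n. x i = y i")
    case True
    then have "{\<omega>. \<forall>i\<le>n. \<omega> i = x i} \<inter> {\<omega>. \<forall>i\<le>m. \<omega> i = y i} = {\<omega>. \<forall>i\<le>m. \<omega> i = y i}"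
      using that by auto
    then show ?thesis by auto
  next
    case False
    then have "{\<omega>. \<forall>i\<le>n. \<omega> i = x i} \<inter> {\<omega>. \<forall>i\<le>m. \<omega> i = y i} = {}"
      using that by fastforce
    then show ?thesis by auto
  qed
  have "{\<omega>. \<forall>i\<le>n. \<omega> i = x i} \<inter> {\<omega>. \<forall>i\<le>m. \<omega> i = y i} \<in> ?G"
    for n m :: nat and x y :: "nat \<Rightarrow> 'a"
    using *[of n m x y] *[of m n y x] by (cases "n \<le> m") (simp_all add: Int_commute)
  then show ?thesis
    unfolding Int_stable_def by (auto simp del: insert_iff)
qed

section \<open>First-step decomposition\<close>

lemma measurable_case_nat_seqs [measurable]: "case_nat s \<in> measurable seqs seqs"
  by measurable

lemma vimage_case_nat_sets [measurable]:
  assumes "E \<in> sets seqs"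
  shows "case_nat s -` E \<in> sets seqs"
  using measurable_sets[OF measurable_case_nat_seqs assms, of s] by (simp add: space_PiM)

text \<open>The right-hand side is the measure \<open>?N\<close>: draw \<open>s\<close> from
  \<open>\<mu>\<close>, run the chain from \<open>P s\<close>, and prepend \<open>s\<close>. Two
  finite measures need only agree on cylinders, where the product formula splits off the weight of
  the first state.\<close>

lemma chain_law_first_step:
  fixes \<mu> :: "'s::countable pmf"
  assumes E: "E \<in> sets seqs"
  shows "emeasure (chain_law \<mu> P) E =
    (\<integral>\<^sup>+s. emeasure (chain_law (P s) P) (case_nat s -` E) \<partial>measure_pmf \<mu>)"
proof -
  let ?D = "\<lambda>s. distr (chain_law (P s) P) seqs (case_nat s)"
  let ?N = "measure_pmf \<mu> \<bind> ?D"
  \<comment> \<open>Every function on a discrete space is measurable, so only the values of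
    \<open>?D\<close> have to be checked.\<close>
  have m [measurable]: "?D \<in> measurable (measure_pmf \<mu>) (subprob_algebra seqs)"
    unfolding measurable_pmf_measure1
  proof (rule Pi_I)
    show "?D s \<in> space (subprob_algebra seqs)" for s
    proof -
      interpret prob_space "chain_law (P s) P" by (rule prob_space_chain_law)
      interpret D: prob_space "?D s" by (rule prob_space_distr) measurable
      show ?thesis
        by (simp add: space_subprob_algebra D.subprob_space_axioms)
    qed
  qed
  have N: "emeasure ?N X = (\<integral>\<^sup>+s. emeasure (chain_law (P s) P) (case_nat s -` X) \<partial>measure_pmf \<mu>)"
    if X: "X \<in> sets seqs" for X
    using X by (subst emeasure_bind[OF _ m X]) (auto simp: emeasure_distr)
  have setsN: "sets ?N = sets seqs"
    by (rule sets_bind) auto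
  let ?G = "insert UNIV (insert {} (range (\<lambda>(n, x). {\<omega>. \<forall>i\<le>n. \<omega> i = x i}))) :: (nat \<Rightarrow> 's) set set"
  have G: "?G \<subseteq> sets seqs"
    unfolding sets_seqs_generated_by_cylinders by (auto intro: sigma_sets.Basic)
  have one: "emeasure (chain_law \<nu> P) UNIV = 1" for \<nu> :: "'s pmf"
    using prob_space.emeasure_space_1[OF prob_space_chain_law[of \<nu> P]] by simp
  have cyl: "emeasure (chain_law \<mu> P) {\<omega>. \<forall>i\<le>n. \<omega> i = x i} =
      (\<integral>\<^sup>+s. emeasure (chain_law (P s) P) (case_nat s -` {\<omega>. \<forall>i\<le>n. \<omega> i = x i}) \<partial>measure_pmf \<mu>)"
    for n and x :: "nat \<Rightarrow> 's"
  proof (cases n)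
    case 0
    have "case_nat s -` {\<omega>. \<forall>i\<le>n. \<omega> i = x i} = (if s = x 0 then UNIV else {})" for s
      using 0 by auto
    then have "emeasure (chain_law (P s) P) (case_nat s -` {\<omega>. \<forall>i\<le>n. \<omega> i = x i}) =
        indicator {x 0} s" for s
      by (simp add: one)
    then show ?thesis
      unfolding emeasure_chain_law_cylinder using 0 by (simp add: emeasure_pmf_single)
  next
    case (Suc m)
    \<comment> \<open>\<open>?c\<close> is the weight of the tail cylinder, shorter by one, when the
      chain starts from the distribution \<open>P (x 0)\<close>.\<close>
    let ?c = "ennreal (pmf (P (x 0)) (x 1) * (\<Prod>i<m. pmf (P (x (Suc i))) (x (Suc (Suc i)))))"
    have "case_nat s -` {\<omega>. \<forall>i\<le>n. \<omega> i = x i} =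
        (if s = x 0 then {\<omega>. \<forall>i\<le>m. \<omega> i = x (Suc i)} else {})" for s
      using Suc by (auto simp: less_Suc_eq_le[symmetric] All_less_Suc2 split: nat.splits)
    then have "emeasure (chain_law (P s) P) (case_nat s -` {\<omega>. \<forall>i\<le>n. \<omega> i = x i}) =
        ?c * indicator {x 0} s" for s
      using emeasure_chain_law_cylinder[of "P (x 0)" P m "\<lambda>i. x (Suc i)"] by simp
    then have "(\<integral>\<^sup>+s. emeasure (chain_law (P s) P) (case_nat s -` {\<omega>. \<forall>i\<le>n. \<omega> i = x i}) \<partial>measure_pmf \<mu>)
        = ?c * ennreal (pmf \<mu> (x 0))"
      by (simp add: nn_integral_cmult_indicator emeasure_pmf_single)
    also have "\<dots> = ennreal (pmf \<mu> (x 0) * (\<Prod>i<n. pmf (P (x i)) (x (Suc i))))"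
      unfolding Suc prod.lessThan_Suc_shift
      by (simp add: ennreal_mult[symmetric] prod_nonneg mult_ac)
    finally show ?thesis
      unfolding emeasure_chain_law_cylinder by simp
  qed
  have "chain_law \<mu> P = ?N"
  proof (rule measure_eqI_generator_eq[OF Int_stable_cylinders, where \<Omega> = UNIV and A = "\<lambda>_. UNIV"])
    show "emeasure (chain_law \<mu> P) X = emeasure ?N X" if "X \<in> ?G" for X
    proof -
      have "X \<in> sets seqs" using that G by blast
      then show ?thesis
        using that cyl by (auto simp: N one simp del: vimage_Collect_eq)
    qed
  qed (simp_all add: setsN sets_seqs_generated_by_cylinders one)
  then show ?thesis using N[OF E] by simp
qed

section \<open>Path probabilities and hitting bounds\<close>

definition path_prob :: "('s::countable \<Rightarrow> 's pmf) \<Rightarrow> 's \<Rightarrow> (nat \<Rightarrow> 's) set \<Rightarrow> ennreal" where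
  "path_prob P s E = emeasure (chain_law (return_pmf s) P) E"

lemma path_prob_eq:
  "E \<in> sets seqs \<Longrightarrow> path_prob P s E = emeasure (chain_law (P s) P) (case_nat s -` E)"
  unfolding path_prob_def by (subst chain_law_first_step) (auto simp: nn_integral_return)

lemma emeasure_chain_law_eq:
  "E \<in> sets seqs \<Longrightarrow> emeasure (chain_law \<mu> P) E = (\<integral>\<^sup>+s. path_prob P s E \<partial>measure_pmf \<mu>)"
  by (subst chain_law_first_step) (simp_all add: path_prob_eq)

lemma path_prob_step:
  "E \<in> sets seqs \<Longrightarrow> path_prob P s E = (\<integral>\<^sup>+u. path_prob P u (case_nat s -` E) \<partial>measure_pmf (P s))"
  by (simp add: path_prob_eq[of E] emeasure_chain_law_eq vimage_case_nat_sets)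

lemma path_prob_UNIV [simp]: "path_prob P s UNIV = 1"
  using prob_space.emeasure_space_1[OF prob_space_chain_law[of "return_pmf s" P]]
  by (simp add: path_prob_def)

lemma path_prob_empty [simp]: "path_prob P s {} = 0"
  by (simp add: path_prob_def)

lemma path_prob_le_1: "path_prob P s E \<le> 1"
  using prob_space.emeasure_le_1[OF prob_space_chain_law[of "return_pmf s" P]]
  by (simp add: path_prob_def)

lemma path_prob_mono: "E \<subseteq> F \<Longrightarrow> F \<in> sets seqs \<Longrightarrow> path_prob P s E \<le> path_prob P s F"
  by (simp add: path_prob_def emeasure_mono)

lemma path_prob_subadditive:
  "E \<in> sets seqs \<Longrightarrow> F \<in> sets seqs \<Longrightarrow> path_prob P s (E \<union> F) \<le> path_prob P s E + path_prob P s F"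
  by (simp add: path_prob_def emeasure_subadditive)

lemma seqs_Collect [measurable (raw)]:
  "Measurable.pred seqs Q \<Longrightarrow> {\<omega>. Q \<omega>} \<in> sets seqs"
  by (drule predE) (simp add: space_PiM)

text \<open>Optional stopping without stopping times: for the events \<open>E n\<close> with horizon
  \<open>n\<close> the bound follows by induction through the first step, and it passes to their
  increasing union. Leaving \<open>T\<close> before reaching \<open>A\<close> contributes
  \<open>0\<close>, so superharmonicity is required only on \<open>T - A\<close>.\<close>

lemma path_prob_until_le:
  fixes f :: "'s::countable \<Rightarrow> ennreal"
  assumes A: "\<And>s. s \<in> A \<Longrightarrow> 1 \<le> f s"
    and T: "\<And>s. s \<in> T - A \<Longrightarrow> (\<integral>\<^sup>+u. f u \<partial>measure_pmf (P s)) \<le> f s"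
  shows "path_prob P s {\<omega>. \<exists>m. \<omega> m \<in> A \<and> (\<forall>j<m. \<omega> j \<in> T)} \<le> f s"
proof -
  define E where "E n = {\<omega> :: nat \<Rightarrow> 's. \<exists>m\<le>n. \<omega> m \<in> A \<and> (\<forall>j<m. \<omega> j \<in> T)}" for n
  have [measurable]: "E n \<in> sets seqs" for n
    unfolding E_def by measurable
  have "path_prob P s (E n) \<le> f s" for n
  proof (induction n arbitrary: s)
    case 0
    have "case_nat s -` E 0 = (if s \<in> A then UNIV else {})"
      by (auto simp: E_def)
    then have "path_prob P s (E 0) = indicator A s"
      by (subst path_prob_step) auto
    then show ?case
      using A[of s] by (auto simp: indicator_def)
  next
    case (Suc n)
    show ?case
    proof (cases "s \<in> A")
      case True
      then show ?thesis using path_prob_le_1 A[of s] order_trans by blast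
    next
      case False
      \<comment> \<open>A hit at time \<open>0\<close> is excluded, so prepending \<open>s\<close>
        delays the hit by one step and adds the constraint that \<open>s\<close> lies in
        \<open>T\<close>.\<close>
      have "case_nat s -` E (Suc n) = (if s \<in> T then E n else {})"
      proof -
        have "(\<exists>m\<le>Suc n. Q m) \<longleftrightarrow> Q 0 \<or> (\<exists>m\<le>n. Q (Suc m))" for Q
          by (auto simp: less_Suc_eq_le[symmetric] Ex_less_Suc2)
        then show ?thesis
          using False by (auto simp: E_def All_less_Suc2)
      qed
      then have "path_prob P s (E (Suc n)) =
          (if s \<in> T then \<integral>\<^sup>+u. path_prob P u (E n) \<partial>measure_pmf (P s) else 0)"
        by (subst path_prob_step) auto
      also have "\<dots> \<le> (if s \<in> T then \<integral>\<^sup>+u. f u \<partial>measure_pmf (P s) else 0)"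
        using Suc by (auto intro: nn_integral_mono)
      also have "\<dots> \<le> f s"
        using T[of s] False by auto
      finally show ?thesis .
    qed
  qed
  moreover have "path_prob P s (\<Union>n. E n) = (SUP n. path_prob P s (E n))"
    unfolding path_prob_def
    by (rule SUP_emeasure_incseq[symmetric]) (auto simp: incseq_def E_def intro: order_trans)
  moreover have "(\<Union>n. E n) = {\<omega>. \<exists>m. \<omega> m \<in> A \<and> (\<forall>j<m. \<omega> j \<in> T)}"
    by (auto simp: E_def)
  ultimately show ?thesis
    by (metis (lifting) SUP_least)
qed

section \<open>Almost sure escape from the region of decrease\<close>

lemma all_nat_split: "(\<forall>j. Q j) \<longleftrightarrow> Q 0 \<and> (\<forall>j. Q (Suc j))"
  by (metis not0_implies_Suc)

text \<open>The bound \<open>H \<le> 1\<close> excludes \<open>H = \<infinity>\<close>, which can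
  satisfy the contraction inequality as well.\<close>

lemma contracted_eq_zero:
  fixes H :: ennreal
  assumes "H \<le> 1" "H \<le> ennreal (1 - c) * H" "0 < c" "c \<le> 1"
  shows "H = 0"
proof -
  obtain h where h: "H = ennreal h" "0 \<le> h"
    using assms(1) by (cases H) (auto simp: top_unique)
  then have "h \<le> (1 - c) * h"
    using assms by (simp add: ennreal_mult[symmetric])
  then have "h = 0"
    using h assms by (simp add: algebra_simps mult_le_0_iff)
  then show ?thesis using h by simp
qed

text \<open>On \<open>T\<close> the value of \<open>W\<close> lies between \<open>0\<close> and
  \<open>R\<close>, so \<open>m\<close> decreases with \<open>R \<le> real m * d\<close>, the same
  \<open>m\<close> for every starting state, drive the chain out of \<open>T\<close>. Escape thus
  has probability at least \<open>q ^ m\<close>, and the supremum \<open>H\<close> of the staying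
  probabilities is contracted by the factor \<open>1 - q ^ m\<close>.\<close>

lemma stay_bounded_null:
  fixes W :: "'s::countable \<Rightarrow> real"
  assumes W: "\<And>s. s \<in> T \<Longrightarrow> 0 < W s \<and> W s \<le> R"
    and q: "0 < q" "q \<le> 1" and d: "0 < d"
    and step: "\<And>s. s \<in> T \<Longrightarrow> measure (measure_pmf (P s)) {u. W u \<le> W s - d} \<ge> q"
  shows "path_prob P s {\<omega>. \<forall>j. \<omega> j \<in> T} = 0"
proof -
  let ?E = "{\<omega> :: nat \<Rightarrow> 's. \<forall>j. \<omega> j \<in> T}"
  define h where "h s = path_prob P s ?E" for s
  define H where "H = (SUP s. h s)"
  have h_H: "h s \<le> H" for s
    unfolding H_def by (rule SUP_upper) simp
  have "H \<le> 1"
    unfolding H_def h_def by (intro SUP_least path_prob_le_1)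
  \<comment> \<open>\<open>H\<close> is finite, and the real number \<open>r\<close> lets the
    average below be split as the integral of a difference.\<close>
  then obtain r where r: "H = ennreal r" "0 \<le> r"
    by (cases H) (auto simp: top_unique)
  have "case_nat s -` ?E = (if s \<in> T then ?E else {})" for s
    by (auto simp: all_nat_split[of "\<lambda>j. case_nat s _ j \<in> T"])
  then have h_step: "h s = (if s \<in> T then \<integral>\<^sup>+u. h u \<partial>measure_pmf (P s) else 0)" for s
    unfolding h_def by (subst path_prob_step) auto
  have le: "h s \<le> ennreal (1 - q ^ m) * H" if "W s \<le> real m * d" for m s
    using that
  proof (induction m arbitrary: s)
    case 0
    then have "s \<notin> T" using W[of s] by auto
    then show ?case by (subst h_step) simp
  next
    case (Suc m)
    show ?case
    proof (cases "s \<in> T")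
      case True
      let ?G = "{u. W u \<le> W s - d}"
      have qm: "0 \<le> q ^ m" "q ^ m \<le> 1"
        using q by (auto intro: power_le_one)
      \<comment> \<open>On \<open>?G\<close> one decrease has been spent and the induction
        hypothesis applies; off \<open>?G\<close> only the trivial bound \<open>H\<close> is
        available. Since \<open>?G\<close> has mass at least \<open>q\<close>, averaging gives the
        factor \<open>1 - q ^ Suc m\<close>.\<close>
      have "h u \<le> ennreal (r - r * q ^ m * indicator ?G u)" for u
      proof (cases "u \<in> ?G")
        case True
        then have "W u \<le> real m * d"
          using Suc.prems by (simp add: algebra_simps)
        from Suc.IH[OF this] show ?thesis
          using True r qm by (simp add: ennreal_mult[symmetric] algebra_simps)
      next
        case False
        then show ?thesis using h_H[of u] r by simp
      qed
      then have "h s \<le> (\<integral>\<^sup>+u. ennreal (r - r * q ^ m * indicator ?G u) \<partial>measure_pmf (P s))"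
        using True by (subst h_step) (auto intro: nn_integral_mono)
      also have "\<dots> = ennreal (\<integral>u. r - r * q ^ m * indicator ?G u \<partial>measure_pmf (P s))"
        using r qm mult_left_mono[of "q ^ m" 1 r]
        by (intro nn_integral_eq_integral measure_pmf.integrable_const_bound[where B=r] AE_I2)
           (auto simp: indicator_def)
      also have "(\<integral>u. r - r * q ^ m * indicator ?G u \<partial>measure_pmf (P s)) =
          r - r * q ^ m * measure (measure_pmf (P s)) ?G"
        by (subst Bochner_Integration.integral_diff) (auto simp: less_top[symmetric])
      also have "\<dots> \<le> r - r * q ^ m * q"
        using r qm step[OF True] by (intro diff_left_mono mult_left_mono) auto
      also have "ennreal (r - r * q ^ m * q) = ennreal (1 - q ^ Suc m) * H"
        using r q power_le_one[of q "Suc m"]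
        by (simp add: ennreal_mult[symmetric] algebra_simps del: power_Suc) (simp add: mult_ac)
      finally show ?thesis by (simp add: ennreal_leI)
    qed (subst h_step, simp)
  qed
  obtain m where m: "R \<le> real m * d"
    using d reals_Archimedean3 less_imp_le by blast
  have "H \<le> ennreal (1 - q ^ m) * H"
    unfolding H_def
  proof (rule SUP_least)
    fix s show "h s \<le> ennreal (1 - q ^ m) * (SUP s. h s)"
    proof (cases "s \<in> T")
      case True
      then show ?thesis using le[of s m] W[of s] m by (simp add: H_def)
    qed (subst h_step, simp)
  qed
  then have "H = 0"
    using contracted_eq_zero[of H "q ^ m"] \<open>H \<le> 1\<close> q by (simp add: power_le_one)
  then show ?thesis
    using h_H[of s] by (simp add: h_def)
qed

text \<open>Truncating at level \<open>R\<close> makes the constants uniform: while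
  \<open>W \<le> R\<close>, antitonicity allows \<open>p R\<close> and \<open>d R\<close> at every
  state. Crossing \<open>R\<close> is a hitting event, bounded through the superharmonic function
  \<open>W / R\<close>.\<close>

lemma stay_null:
  fixes W :: "'s::countable \<Rightarrow> real" and d p :: "real \<Rightarrow> real"
  assumes nonneg: "\<And>s. 0 \<le> W s" and pos: "\<And>s. s \<in> T \<Longrightarrow> 0 < W s"
    and super: "\<And>s. s \<in> T \<Longrightarrow> (\<integral>\<^sup>+u. ennreal (W u) \<partial>measure_pmf (P s)) \<le> ennreal (W s)"
    and step: "\<And>s. s \<in> T \<Longrightarrow> p (W s) \<le> measure (measure_pmf (P s)) {u. W u \<le> W s - d (W s)}"
    and p: "\<And>r. 0 < r \<Longrightarrow> 0 < p r \<and> p r \<le> 1" and d: "\<And>r. 0 < r \<Longrightarrow> 0 < d r"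
    and p_anti: "\<And>r r'. 0 < r \<Longrightarrow> r \<le> r' \<Longrightarrow> p r' \<le> p r"
    and d_anti: "\<And>r r'. 0 < r \<Longrightarrow> r \<le> r' \<Longrightarrow> d r' \<le> d r"
  shows "path_prob P s {\<omega>. \<forall>j. \<omega> j \<in> T} = 0"
proof -
  have bound: "path_prob P s {\<omega>. \<forall>j. \<omega> j \<in> T} \<le> ennreal (W s / R)" if R: "0 < R" for R
  proof -
    let ?T = "T \<inter> {s. W s \<le> R}"
    have 0: "path_prob P s {\<omega>. \<forall>j. \<omega> j \<in> ?T} = 0"
    proof (rule stay_bounded_null[where W = W and q = "p R" and d = "d R" and R = R])
      fix s assume s: "s \<in> ?T"
      then have "p R \<le> p (W s)" "d R \<le> d (W s)"
        using pos p_anti d_anti by auto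
      then have "p R \<le> measure (measure_pmf (P s)) {u. W u \<le> W s - d (W s)}"
        using step[of s] s by auto
      also have "\<dots> \<le> measure (measure_pmf (P s)) {u. W u \<le> W s - d R}"
        using \<open>d R \<le> d (W s)\<close> by (intro measure_pmf.finite_measure_mono) auto
      finally show "p R \<le> measure (measure_pmf (P s)) {u. W u \<le> W s - d R}" .
    qed (use pos p d R in auto)
    have 1: "path_prob P s {\<omega>. \<exists>m. \<omega> m \<in> {s. W s > R} \<and> (\<forall>j<m. \<omega> j \<in> T)} \<le> ennreal (W s / R)"
    proof (rule path_prob_until_le)
      show "1 \<le> ennreal (W s / R)" if "s \<in> {s. R < W s}" for s
        using that R by (simp add: ennreal_ge_1)
      show "(\<integral>\<^sup>+u. ennreal (W u / R) \<partial>measure_pmf (P s)) \<le> ennreal (W s / R)"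
        if "s \<in> T - {s. R < W s}" for s
      proof -
        have "(\<integral>\<^sup>+u. ennreal (W u / R) \<partial>measure_pmf (P s)) =
            (\<integral>\<^sup>+u. ennreal (W u) \<partial>measure_pmf (P s)) / ennreal R"
          using R nonneg by (simp add: divide_ennreal[symmetric] nn_integral_divide)
        also have "\<dots> \<le> ennreal (W s) / ennreal R"
          using super[of s] that by (intro divide_right_mono_ennreal) auto
        finally show ?thesis
          using R nonneg by (simp add: divide_ennreal)
      qed
    qed
    \<comment> \<open>A path that stays in \<open>T\<close> either keeps \<open>W\<close> at most
      \<open>R\<close> or exceeds \<open>R\<close> at some time, before which it was in
      \<open>T\<close>.\<close>
    have "path_prob P s {\<omega>. \<forall>j. \<omega> j \<in> T} \<le> path_prob P s ({\<omega>. \<forall>j. \<omega> j \<in> ?T} \<union>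
        {\<omega>. \<exists>m. \<omega> m \<in> {s. W s > R} \<and> (\<forall>j<m. \<omega> j \<in> T)})"
      by (rule path_prob_mono) (auto simp: not_le[symmetric] simp del: not_le)
    also have "\<dots> \<le> 0 + ennreal (W s / R)"
      by (rule order_trans[OF path_prob_subadditive]) (measurable, use 0 1 in simp)
    finally show ?thesis by simp
  qed
  show ?thesis
  proof (rule antisym)
    \<comment> \<open>The levels are \<open>R = n + 1\<close>, so that \<open>R\<close> is never
      \<open>0\<close>.\<close>
    have "(\<lambda>n. ennreal (W s / real (Suc n))) \<longlonglongrightarrow> ennreal 0"
      by (intro tendsto_ennrealI LIMSEQ_Suc[OF lim_const_over_n])
    then show "path_prob P s {\<omega>. \<forall>j. \<omega> j \<in> T} \<le> 0"
      unfolding ennreal_0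
      by (rule LIMSEQ_le_const) (use bound in auto)
  qed simp
qed

section \<open>Shift-invariant events and Streett pairs\<close>

lemma eventually_stay_null:
  fixes P :: "'s::countable \<Rightarrow> 's pmf"
  assumes "\<And>s. path_prob P s {\<omega>. \<forall>j. \<omega> j \<in> T} = 0"
  shows "path_prob P s {\<omega>. \<exists>n. \<forall>m\<ge>n. \<omega> m \<in> T} = 0"
proof -
  let ?E = "\<lambda>n. {\<omega> :: nat \<Rightarrow> 's. \<forall>m\<ge>n. \<omega> m \<in> T}"
  have "path_prob P s (?E n) = 0" for n
  proof (induction n arbitrary: s)
    case (Suc n)
    \<comment> \<open>For \<open>Suc n\<close> the constraint at time \<open>0\<close> is void, so
      the first step is discarded and the chain restarts from an arbitrary state.\<close>
    have "case_nat s -` ?E (Suc n) = ?E n"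
      by (auto simp: all_nat_split[of "\<lambda>m. Suc n \<le> m \<longrightarrow> case_nat s _ m \<in> T"])
    then show ?case
      by (subst path_prob_step) (use Suc in auto)
  qed (use assms in simp)
  then have "path_prob P s (\<Union>n. ?E n) = 0"
    unfolding path_prob_def by (intro emeasure_UN_eq_0) auto
  also have "(\<Union>n. ?E n) = {\<omega>. \<exists>n. \<forall>m\<ge>n. \<omega> m \<in> T}" by auto
  finally show ?thesis .
qed

text \<open>This replaces the strong Markov property at the first entrance into \<open>A\<close>.
  Shift invariance makes \<open>path_prob P s E\<close> harmonic in \<open>s\<close>, so induction
  on \<open>n\<close> can separate the paths that visit \<open>A\<close> up to time \<open>n\<close>
  (\<open>?F n\<close>) from those of \<open>E\<close> that do not (\<open>?G n\<close>). The latter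
  decrease to an event that is null by \<open>reach\<close>.\<close>

lemma shift_invariant_le_reach:
  fixes H :: ennreal
  assumes E [measurable]: "E \<in> sets seqs" and inv: "\<And>s. case_nat s -` E = E"
    and reach: "path_prob P s (E \<inter> {\<omega>. \<forall>m. \<omega> m \<notin> A}) = 0"
    and H: "\<And>s. s \<in> A \<Longrightarrow> path_prob P s E \<le> H"
  shows "path_prob P s E \<le> H * path_prob P s {\<omega>. \<exists>m. \<omega> m \<in> A}"
proof -
  let ?F = "\<lambda>n. {\<omega>. \<exists>m\<le>n. \<omega> m \<in> A}" and ?G = "\<lambda>n. E \<inter> {\<omega>. \<forall>m\<le>n. \<omega> m \<notin> A}"
  have mF [measurable]: "?F n \<in> sets seqs" and mG [measurable]: "?G n \<in> sets seqs" for n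
    by measurable
  have stepE: "path_prob P s E = (\<integral>\<^sup>+u. path_prob P u E \<partial>measure_pmf (P s))" for s
    using path_prob_step[OF E, of P s] inv by simp
  have le: "path_prob P s E \<le> H * path_prob P s (?F n) + path_prob P s (?G n)" for n s
  proof (induction n arbitrary: s)
    case 0
    have F: "case_nat s -` ?F 0 = (if s \<in> A then UNIV else {})"
      by auto
    have G: "case_nat s -` ?G 0 = (if s \<in> A then {} else E)"
      using inv[of s] by auto
    have "path_prob P s (?F 0) = (if s \<in> A then 1 else 0)"
      using path_prob_step[OF mF, of P s 0] unfolding F by simp
    moreover have "path_prob P s (?G 0) = (if s \<in> A then 0 else path_prob P s E)"
      using path_prob_step[OF mG, of P s 0] unfolding G stepE[of s] by simp
    ultimately show ?case using H[of s] by auto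
  next
    case (Suc n)
    have split: "(\<forall>m\<le>Suc n. Q m) \<longleftrightarrow> Q 0 \<and> (\<forall>m\<le>n. Q (Suc m))"
      "(\<exists>m\<le>Suc n. Q m) \<longleftrightarrow> Q 0 \<or> (\<exists>m\<le>n. Q (Suc m))" for Q
      by (auto simp: less_Suc_eq_le[symmetric] Ex_less_Suc2 All_less_Suc2)
    have F: "case_nat s -` ?F (Suc n) = (if s \<in> A then UNIV else ?F n)"
      by (auto simp: split)
    have G: "case_nat s -` ?G (Suc n) = (if s \<in> A then {} else ?G n)"
      using inv[of s] by (auto simp: split)
    have *: "path_prob P s (?F (Suc n)) =
        (if s \<in> A then 1 else \<integral>\<^sup>+u. path_prob P u (?F n) \<partial>measure_pmf (P s))"
      using path_prob_step[OF mF, of P s "Suc n"] unfolding F by simp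
    have **: "path_prob P s (?G (Suc n)) =
        (if s \<in> A then 0 else \<integral>\<^sup>+u. path_prob P u (?G n) \<partial>measure_pmf (P s))"
      using path_prob_step[OF mG, of P s "Suc n"] unfolding G by simp
    show ?case
    proof (cases "s \<in> A")
      case True
      then show ?thesis using H[of s] * ** by simp
    next
      case False
      have "path_prob P s E = (\<integral>\<^sup>+u. path_prob P u E \<partial>measure_pmf (P s))"
        by (rule stepE)
      also have "\<dots> \<le> (\<integral>\<^sup>+u. H * path_prob P u (?F n) + path_prob P u (?G n) \<partial>measure_pmf (P s))"
        using Suc by (intro nn_integral_mono) auto
      also have "\<dots> = H * path_prob P s (?F (Suc n)) + path_prob P s (?G (Suc n))"
        using False * ** by (simp add: nn_integral_add nn_integral_cmult)
      finally show ?thesis .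
    qed
  qed
  have "(\<lambda>n. path_prob P s (?G n)) \<longlonglongrightarrow> path_prob P s (\<Inter>n. ?G n)"
    unfolding path_prob_def
  proof (rule Lim_emeasure_decseq)
    show "emeasure (chain_law (return_pmf s) P) (?G n) \<noteq> \<infinity>" for n
      using path_prob_le_1[of P s "?G n"] by (auto simp: path_prob_def top_unique)
  qed (auto simp: decseq_def)
  moreover have "(\<Inter>n. ?G n) = E \<inter> {\<omega>. \<forall>m. \<omega> m \<notin> A}" by auto
  ultimately have "(\<lambda>n. H * path_prob P s {\<omega>. \<exists>m. \<omega> m \<in> A} + path_prob P s (?G n))
      \<longlonglongrightarrow> H * path_prob P s {\<omega>. \<exists>m. \<omega> m \<in> A} + 0"
    using reach by (intro tendsto_add tendsto_const) simp
  then show ?thesis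
    unfolding add_0_right
  proof (rule LIMSEQ_le_const, intro exI allI impI)
    fix n
    have "path_prob P s (?F n) \<le> path_prob P s {\<omega>. \<exists>m. \<omega> m \<in> A}"
      by (rule path_prob_mono) auto
    then show "path_prob P s E \<le> H * path_prob P s {\<omega>. \<exists>m. \<omega> m \<in> A} + path_prob P s (?G n)"
      using le[of s n] by (meson add_right_mono mult_left_mono order_trans zero_le)
  qed
qed

lemma streett_pair_null:
  fixes P :: "'s::countable \<Rightarrow> 's pmf" and V :: "'s \<Rightarrow> real"
  assumes stay: "\<And>s. path_prob P s {\<omega>. \<forall>j. \<omega> j \<in> I - (B \<union> J)} = 0"
    and V_nonneg: "\<And>s. 0 \<le> V s"
    and V_super: "\<And>s. s \<notin> A \<Longrightarrow> (\<integral>\<^sup>+u. ennreal (V u) \<partial>measure_pmf (P s)) \<le> ennreal (V s)"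
    and V_A: "\<And>s. s \<in> A \<Longrightarrow> 1 \<le> V s"
    and V_J: "\<And>s. s \<in> J \<Longrightarrow> V s \<le> 1 - c" and c: "0 < c" "c \<le> 1"
  shows "path_prob P s (fin_visits (- I) \<inter> fin_visits B \<inter> inf_visits A) = 0"
proof -
  let ?E = "fin_visits (- I) \<inter> fin_visits B \<inter> inf_visits A"
  have [measurable]: "fin_visits X \<in> sets seqs" "inf_visits X \<in> sets seqs" for X :: "'s set"
    using sets_fin_visits[of X] sets_inf_visits[of X] by simp_all
  have fin: "\<omega> \<in> fin_visits X \<longleftrightarrow> (\<exists>n. \<forall>m\<ge>n. \<omega> m \<notin> X)" for \<omega> and X :: "'s set"
    by (auto simp: fin_visits_def)
  have "case_nat s -` fin_visits X = fin_visits X" for s and X :: "'s set"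
  proof -
    \<comment> \<open>What holds eventually is unchanged by a shift of one step.\<close>
    have "(\<exists>n. \<forall>m\<ge>n. case_nat s \<omega> m \<notin> X) \<longleftrightarrow> (\<exists>n. \<forall>m\<ge>n. \<omega> m \<notin> X)" for \<omega>
      using eventually_sequentially_Suc[of "\<lambda>m. case_nat s \<omega> m \<notin> X"]
      by (simp add: eventually_sequentially)
    then show ?thesis by (simp add: set_eq_iff fin)
  qed
  then have inv: "case_nat s -` ?E = ?E" for s
    by (simp add: inf_visits_eq vimage_Diff)
  define H where "H = (SUP s. path_prob P s ?E)"
  have H: "path_prob P s ?E \<le> H" for s
    unfolding H_def by (rule SUP_upper) simp
  have le_V: "path_prob P s ?E \<le> H * ennreal (V s)" for s
  proof -
    \<comment> \<open>Infinitely many visits to \<open>A\<close> include at least one, so the event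
      required to be null is even empty.\<close>
    have "?E \<inter> {\<omega>. \<forall>m. \<omega> m \<notin> A} = {}"
      by (auto simp: inf_visits_def)
    then have "path_prob P s ?E \<le> H * path_prob P s {\<omega>. \<exists>m. \<omega> m \<in> A}"
      by (intro shift_invariant_le_reach inv H) auto
    also have "path_prob P s {\<omega>. \<exists>m. \<omega> m \<in> A} \<le> ennreal (V s)"
      using path_prob_until_le[of A "\<lambda>s. ennreal (V s)" UNIV P s] V_A V_super
      by (simp add: ennreal_ge_1)
    finally show ?thesis by (simp add: mult_left_mono)
  qed
  have "path_prob P s ?E \<le> ennreal (1 - c) * H" for s
  proof -
    \<comment> \<open>A path of \<open>?E\<close> that avoids \<open>J\<close> is eventually in
      \<open>I - (B \<union> J)\<close>, which has probability \<open>0\<close>; hence almost every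
      path of \<open>?E\<close> reaches \<open>J\<close>.\<close>
    have "path_prob P s (?E \<inter> {\<omega>. \<forall>m. \<omega> m \<notin> J}) \<le>
        path_prob P s {\<omega>. \<exists>n. \<forall>m\<ge>n. \<omega> m \<in> I - (B \<union> J)}"
    proof (rule path_prob_mono)
      show "?E \<inter> {\<omega>. \<forall>m. \<omega> m \<notin> J} \<subseteq> {\<omega>. \<exists>n. \<forall>m\<ge>n. \<omega> m \<in> I - (B \<union> J)}"
      proof (clarsimp simp: fin_visits_def)
        fix \<omega> :: "nat \<Rightarrow> 's" and n n'
        assume "\<forall>m\<in>{n..}. \<omega> m \<in> I" "\<forall>m\<in>{n'..}. \<omega> m \<notin> B"
        then show "\<exists>n. \<forall>m\<ge>n. \<omega> m \<in> I \<and> \<omega> m \<notin> B"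
          by (intro exI[of _ "max n n'"]) auto
      qed
    qed measurable
    then have 0: "path_prob P s (?E \<inter> {\<omega>. \<forall>m. \<omega> m \<notin> J}) = 0"
      using eventually_stay_null[OF stay] by simp
    have "path_prob P u ?E \<le> ennreal (1 - c) * H" if "u \<in> J" for u
    proof -
      have "H * ennreal (V u) \<le> H * ennreal (1 - c)"
        using V_J[OF that] by (intro mult_left_mono ennreal_leI) auto
      then show ?thesis using le_V[of u] by (simp add: mult.commute)
    qed
    \<comment> \<open>The bound valid on \<open>J\<close> now takes the place of \<open>H\<close> in
      the lemma; bounding the hitting probability by \<open>1\<close> makes it uniform in
      \<open>s\<close>.\<close>
    then have "path_prob P s ?E \<le> ennreal (1 - c) * H * path_prob P s {\<omega>. \<exists>m. \<omega> m \<in> J}"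
      by (intro shift_invariant_le_reach inv 0) auto
    also have "\<dots> \<le> ennreal (1 - c) * H * 1"
      by (intro mult_left_mono path_prob_le_1) simp
    finally show ?thesis by simp
  qed
  then have "H \<le> ennreal (1 - c) * H"
    unfolding H_def by (intro SUP_least) simp
  moreover have "H \<le> 1"
    unfolding H_def by (intro SUP_least path_prob_le_1)
  ultimately have "H = 0"
    using contracted_eq_zero c by blast
  then show ?thesis using H[of s] by simp
qed

section \<open>The bound for the whole acceptance condition\<close>

theorem theorem4p8:
  fixes \<mu> :: "'s::countable pmf"
    and P :: "'s \<Rightarrow> 's pmf"
    and k :: nat
    and A B :: "nat \<Rightarrow> 's set"
    and I :: "'s set"
    and V\<^sub>0 :: "'s \<Rightarrow> real"
    and J :: "nat \<Rightarrow> 's set"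
    and V W :: "nat \<Rightarrow> 's \<Rightarrow> real"
    and d p :: "nat \<Rightarrow> real \<Rightarrow> real"
  assumes V0_nonneg: "\<And>s. V\<^sub>0 s \<ge> 0"
    and J_subset: "\<And>i. i \<in> {1..k} \<Longrightarrow> J i \<subseteq> I - A i"
    and V_nonneg: "\<And>i s. i \<in> {1..k} \<Longrightarrow> V i s \<ge> 0"
    and W_nonneg: "\<And>i s. i \<in> {1..k} \<Longrightarrow> W i s \<ge> 0"
    and d_pos: "\<And>i r. i \<in> {1..k} \<Longrightarrow> r \<ge> 0 \<Longrightarrow> d i r > 0"
    and p_range: "\<And>i r. i \<in> {1..k} \<Longrightarrow> r \<ge> 0 \<Longrightarrow> p i r \<in> {0<..1}"
    and c1: "\<And>i. i \<in> {1..k} \<Longrightarrow> \<forall>s. s \<notin> A i \<longrightarrow> kernel_sum P (V i) s \<le> ennreal (V i s)"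
    and c2: "\<And>i. i \<in> {1..k} \<Longrightarrow> \<forall>s\<in>A i. V i s \<ge> 1"
    and c3: "\<And>i. i \<in> {1..k} \<Longrightarrow> \<exists>\<gamma>>0. \<forall>s\<in>J i. V i s \<le> 1 - \<gamma>"
    and c4: "\<And>i. i \<in> {1..k} \<Longrightarrow> \<forall>s\<in>I - (B i \<union> J i). W i s > 0"
    and c5: "\<And>i. i \<in> {1..k} \<Longrightarrow> \<forall>s\<in>I \<inter> (B i \<union> J i). W i s = 0"
    and c6: "\<And>i. i \<in> {1..k} \<Longrightarrow>
      \<forall>s\<in>I - (B i \<union> J i). kernel_sum P (W i) s \<le> ennreal (W i s)"
    and c7: "\<And>i. i \<in> {1..k} \<Longrightarrow> \<forall>r>0. \<forall>s\<in>I - (B i \<union> J i). W i s = r \<longrightarrow>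
      measure (measure_pmf (P s)) {s'. W i s' \<le> r - d i r} \<ge> p i r"
    and c8: "\<And>i. i \<in> {1..k} \<Longrightarrow> \<forall>r1>0. \<forall>r2>0. r1 \<le> r2 \<longrightarrow> p i r1 \<ge> p i r2"
    and c9: "\<And>i. i \<in> {1..k} \<Longrightarrow> \<forall>r1>0. \<forall>r2>0. r1 \<le> r2 \<longrightarrow> d i r1 \<ge> d i r2"
    and c10: "\<forall>s\<in>I. kernel_sum P V\<^sub>0 s \<le> ennreal (V\<^sub>0 s)"
    and c11: "\<forall>s. s \<notin> I \<longrightarrow> V\<^sub>0 s \<ge> 1"
  shows "ereal (measure (chain_law \<mu> P) (\<Inter>i\<in>{1..k}. fin_visits (A i) \<union> inf_visits (B i)))
    \<ge> 1 - enn2ereal (pmf_sum \<mu> V\<^sub>0)"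
proof -
  let ?M = "chain_law \<mu> P"
  interpret prob_space ?M by (rule prob_space_chain_law)
  let ?bad = "\<lambda>i. fin_visits (- I) \<inter> fin_visits (B i) \<inter> inf_visits (A i)"
  let ?exit = "{\<omega>. \<exists>m. \<omega> m \<in> - I}"
  let ?good = "\<Inter>i\<in>{1..k}. fin_visits (A i) \<union> inf_visits (B i)"
  have [measurable]: "fin_visits X \<in> sets seqs" "inf_visits X \<in> sets seqs" for X :: "'s set"
    using sets_fin_visits[of X] sets_inf_visits[of X] by simp_all
  have bad: "path_prob P s (?bad i) = 0" if i: "i \<in> {1..k}" for i s
  proof -
    obtain \<gamma> where \<gamma>: "\<gamma> > 0" "\<forall>s\<in>J i. V i s \<le> 1 - \<gamma>"
      using c3[OF i] by blast
    show ?thesis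
    \<comment> \<open>If \<open>J i\<close> is empty, \<open>\<gamma>\<close> may exceed
      \<open>1\<close>; the minimum keeps \<open>c \<le> 1\<close> and only weakens the bound on
      \<open>V i\<close>.\<close>
    proof (rule streett_pair_null[where V = "V i" and J = "J i" and c = "min \<gamma> 1"])
      show "path_prob P s {\<omega>. \<forall>j. \<omega> j \<in> I - (B i \<union> J i)} = 0" for s
      proof (rule stay_null[where W = "W i" and p = "p i" and d = "d i"])
        show "(\<integral>\<^sup>+u. ennreal (W i u) \<partial>measure_pmf (P s)) \<le> ennreal (W i s)"
          if "s \<in> I - (B i \<union> J i)" for s
          unfolding kernel_sum_eq_nn_integral[of "W i" P s, OF W_nonneg[OF i], symmetric]
          using c6[OF i] that by blast
        show "p i (W i s) \<le> measure (measure_pmf (P s)) {u. W i u \<le> W i s - d i (W i s)}"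
          if "s \<in> I - (B i \<union> J i)" for s
          using c7[OF i] c4[OF i] that by blast
        show "0 < p i r \<and> p i r \<le> 1" if "0 < r" for r
          using p_range[OF i, of r] that by simp
        show "p i r' \<le> p i r" "d i r' \<le> d i r" if "0 < r" "r \<le> r'" for r r'
          using c8[OF i] c9[OF i] that by auto
      qed (use W_nonneg[OF i] c4[OF i] d_pos[OF i] in auto)
      show "(\<integral>\<^sup>+u. ennreal (V i u) \<partial>measure_pmf (P s)) \<le> ennreal (V i s)" if "s \<notin> A i" for s
        unfolding kernel_sum_eq_nn_integral[of "V i" P s, OF V_nonneg[OF i], symmetric]
        using c1[OF i] that by blast
    qed (use V_nonneg[OF i] c2[OF i] \<gamma> in auto)
  qed
  have exit: "emeasure ?M ?exit \<le> pmf_sum \<mu> V\<^sub>0"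
  proof -
    have "path_prob P s ?exit \<le> ennreal (V\<^sub>0 s)" for s
      using path_prob_until_le[of "- I" "\<lambda>s. ennreal (V\<^sub>0 s)" UNIV P s] c10 c11
        kernel_sum_eq_nn_integral[of V\<^sub>0 P] V0_nonneg
      by (simp add: ennreal_ge_1)
    then show ?thesis
      by (subst emeasure_chain_law_eq)
         (auto simp: pmf_sum_eq_nn_integral V0_nonneg intro: nn_integral_mono)
  qed
  \<comment> \<open>A path violating pair \<open>i\<close> visits \<open>A i\<close> infinitely
    often and \<open>B i\<close> finitely often; if it never leaves \<open>I\<close>, it lies in
    \<open>?bad i\<close>.\<close>
  have "emeasure ?M (space ?M - ?good) \<le> emeasure ?M (?exit \<union> (\<Union>i\<in>{1..k}. ?bad i))"
  proof (rule emeasure_mono)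
    have "\<omega> \<in> fin_visits (- I)" if "\<omega> \<notin> ?exit" for \<omega>
      using that by (auto simp: fin_visits_def)
    then show "space ?M - ?good \<subseteq> ?exit \<union> (\<Union>i\<in>{1..k}. ?bad i)"
      by (auto simp: inf_visits_eq)
  qed auto
  also have "\<dots> \<le> emeasure ?M ?exit + emeasure ?M (\<Union>i\<in>{1..k}. ?bad i)"
    by (rule emeasure_subadditive) auto
  also have "emeasure ?M (\<Union>i\<in>{1..k}. ?bad i) = 0"
    using bad
    by (intro null_setsD1[OF null_sets_UN']) (auto simp: emeasure_chain_law_eq intro!: null_setsI)
  finally have le: "emeasure ?M (space ?M - ?good) \<le> pmf_sum \<mu> V\<^sub>0"
    using exit by simp
  show ?thesis
  \<comment> \<open>If the sum is infinite, the lower bound is minus infinity and the claim is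
    trivial.\<close>
  proof (cases "pmf_sum \<mu> V\<^sub>0")
    case (real x)
    \<comment> \<open>For \<open>k = 0\<close> the intersection is over an empty index set and
      equals \<open>UNIV\<close>.\<close>
    have "?good \<in> sets ?M"
      using sets.top[of ?M] by (cases "k = 0") auto
    then have "prob (space ?M - ?good) = 1 - prob ?good"
      by (rule prob_compl)
    moreover have "prob (space ?M - ?good) \<le> x"
      using le real by (simp add: emeasure_eq_measure)
    ultimately show ?thesis
      using real by (simp add: one_ereal_def del: ereal_eq_1)
  qed (simp add: one_ereal_def)
qed

end
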